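(* In the online setting, consider any online procedure $\mathcal A=(\alpha_k,k\ge1)$ and assume that the null $p$-values are conditionally super-uniform: $\mathbf P(p_k\le x\mid\mathcal G_{k-1})\le x$ for all $x\in[0,1]$ and $k\in\mathcal H_0$. Let $R_k=\{1\le i\le k:p_i\le\alpha_i\}$ and $R(k)=|R_k|$. Then for any $\delta\in(0,1)$, setting $$\overline{\mathrm{FDP}}^{\mathrm{Freed}}_{\mathcal A,k}=1\wedge\frac{\sum_{i=1}^k\alpha_i+\Delta\bigl(\sum_{i=1}^k\alpha_i\bigr)}{1\vee R(k)},\qquad k\ge1,$$ where $\Delta(u)=2\sqrt{\varepsilon_u}\sqrt{u\vee1}+\frac12\varepsilon_u$, $\varepsilon_u=\log((1+\kappa)/\delta)+2\log(1+\log_2(u\vee1))$ and $\kappa=\pi^2/6$, one has $$\mathbf P\bigl(\forall k\ge1,\ \mathrm{FDP}(R_k)\le\overline{\mathrm{FDP}}^{\mathrm{Freed}}_{\mathcal A,k}\bigr)\ge1-\delta.$$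
   Context: Online setting: $p_1,p_2,\dots$ is an infinite sequence of $[0,1]$-valued $p$-values for null hypotheses $H_1,H_2,\dots$; $\mathcal H_0\subset\{1,2,\dots\}$ is the (fixed) set of indices of true nulls. An online procedure is a sequence $\mathcal A=(\alpha_k,k\ge1)$ of $[0,1]$-valued critical values, rejecting $H_k$ if $p_k\le\alpha_k$, that is predictable: $\alpha_{k+1}$ is measurable with respect to $\mathcal G_k=\sigma(\mathbf 1\{p_i\le\alpha_i\},i\le k)$ for $k\ge0$ ($\mathcal G_0$ trivial, so $\alpha_1$ is deterministic). $\mathrm{FDP}(R)=|R\cap\mathcal H_0|/(|R|\vee1)$. *)

theory Defs
  imports "HOL-Probability.Probability"
begin

text \<open>Hypotheses are indexed by the positive integers; the values at index 0 of the
  sequences \<open>p\<close> and \<open>\<alpha>\<close> play no role.\<close>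

definition rejections ::
    "(nat \<Rightarrow> 'a \<Rightarrow> real) \<Rightarrow> (nat \<Rightarrow> 'a \<Rightarrow> real) \<Rightarrow> nat \<Rightarrow> 'a \<Rightarrow> nat set" where
  "rejections p \<alpha> k \<omega> = {i. 1 \<le> i \<and> i \<le> k \<and> p i \<omega> \<le> \<alpha> i \<omega>}"

text \<open>The sigma-algebra generated by the indicator variables of \<open>p i \<le> \<alpha> i\<close> for
  \<open>1 \<le> i \<le> k\<close>; it is trivial for \<open>k = 0\<close>.\<close>

definition rejection_sigma ::
    "'a measure \<Rightarrow> (nat \<Rightarrow> 'a \<Rightarrow> real) \<Rightarrow> (nat \<Rightarrow> 'a \<Rightarrow> real) \<Rightarrow> nat \<Rightarrow> 'a measure" where
  "rejection_sigma M p \<alpha> k =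
     sigma (space M)
       (\<Union>i\<in>{1..k}. {(indicat_real {\<omega>. p i \<omega> \<le> \<alpha> i \<omega>}) -` B \<inter> space M | B. B \<in> sets borel})"

definition online_procedure ::
    "'a measure \<Rightarrow> (nat \<Rightarrow> 'a \<Rightarrow> real) \<Rightarrow> (nat \<Rightarrow> 'a \<Rightarrow> real) \<Rightarrow> bool" where
  "online_procedure M p \<alpha> \<longleftrightarrow>
     (\<forall>k\<ge>1. \<forall>\<omega>\<in>space M. \<alpha> k \<omega> \<in> {0..1}) \<and>
     (\<forall>k. \<alpha> (k + 1) \<in> borel_measurable (rejection_sigma M p \<alpha> k))"

text \<open>The exceptional null set may depend on \<open>x\<close>.\<close>

definition cond_super_uniform ::
    "'a measure \<Rightarrow> nat set \<Rightarrow> (nat \<Rightarrow> 'a \<Rightarrow> real) \<Rightarrow> (nat \<Rightarrow> 'a \<Rightarrow> real) \<Rightarrow> bool" where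
  "cond_super_uniform M H0 p \<alpha> \<longleftrightarrow>
     (\<forall>k\<in>H0. \<forall>x\<in>{0..1}. AE \<omega> in M.
        real_cond_exp M (rejection_sigma M p \<alpha> (k - 1)) (indicat_real {\<omega>. p k \<omega> \<le> x}) \<omega> \<le> x)"

definition FDP :: "nat set \<Rightarrow> nat set \<Rightarrow> real" where
  "FDP H0 R = real (card (R \<inter> H0)) / max (real (card R)) 1"

definition freed_kappa :: real where
  "freed_kappa = pi\<^sup>2 / 6"

definition freed_eps :: "real \<Rightarrow> real \<Rightarrow> real" where
  "freed_eps \<delta> u = ln ((1 + freed_kappa) / \<delta>) + 2 * ln (1 + log 2 (max u 1))"

definition freed_Delta :: "real \<Rightarrow> real \<Rightarrow> real" where
  "freed_Delta \<delta> u = 2 * sqrt (freed_eps \<delta> u) * sqrt (max u 1) + freed_eps \<delta> u / 2"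

definition FDP_bar_Freed ::
    "real \<Rightarrow> (nat \<Rightarrow> 'a \<Rightarrow> real) \<Rightarrow> (nat \<Rightarrow> 'a \<Rightarrow> real) \<Rightarrow> nat \<Rightarrow> 'a \<Rightarrow> real" where
  "FDP_bar_Freed \<delta> p \<alpha> k \<omega> =
     min 1 (((\<Sum>i=1..k. \<alpha> i \<omega>) + freed_Delta \<delta> (\<Sum>i=1..k. \<alpha> i \<omega>))
            / max 1 (real (card (rejections p \<alpha> k \<omega>))))"

end

theory Submission
  imports Defs
begin

text \<open>
  Let \<open>N\<^sub>k\<close> be the number of false rejections among the first \<open>k\<close> hypotheses and
  \<open>S\<^sub>k = \<alpha>\<^sub>1 + \<dots> + \<alpha>\<^sub>k\<close>.  Conditional super-uniformity makes
  \<open>exp (\<lambda> N\<^sub>k - (exp \<lambda> - 1) S\<^sub>k)\<close> a nonnegative supermartingale for every \<open>\<lambda> \<ge> 0\<close>, so Ville's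
  inequality bounds the probability that it ever reaches a level \<open>exp \<epsilon>\<close> by \<open>exp (-\<epsilon>)\<close>.
  For \<open>S\<^sub>k \<le> v\<close> and the Bernstein choice \<open>\<lambda> = 2 / (1 + 2 s)\<close> with \<open>s = sqrt (v / (2 \<epsilon>))\<close>,
  not reaching that level implies \<open>N\<^sub>k < S\<^sub>k + sqrt (2 v \<epsilon>) + \<epsilon> / 2\<close>.  This is applied on the dyadic
  scales \<open>v = 2\<^bsup>j+1\<^esup>\<close> with error budget \<open>\<delta> / ((1 + \<kappa>) (j + 1)\<^sup>2)\<close>, whose sum over \<open>j\<close> is
  \<open>\<delta> \<kappa> / (1 + \<kappa>)\<close>.
\<close>

section \<open>Exponential inequalities and the Bernstein choice of the tilt\<close>

text \<open>The right-hand side is the (1,1) Pade approximant of the exponential. The function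
  \<open>f\<close> vanishes at 0 and has derivative \<open>1 - (1 + t) * exp (- t)\<close>, which is
  nonnegative because \<open>1 + t \<le> exp t\<close>.\<close>

lemma exp_le_two_plus_over_two_minus:
  fixes x :: real
  assumes "0 \<le> x" "x < 2"
  shows "exp x \<le> (2 + x) / (2 - x)"
proof -
  define f where "f = (\<lambda>t::real. (2 + t) * exp (- t) - (2 - t))"
  have "f 0 \<le> f x"
  proof (rule DERIV_nonneg_imp_nondecreasing[OF assms(1)])
    fix t :: real assume t: "0 \<le> t" "t \<le> x"
    have "(f has_real_derivative (1 - (1 + t) * exp (- t))) (at t)"
      unfolding f_def by (auto intro!: derivative_eq_intros simp: algebra_simps)
    moreover have "(1 + t) * exp (- t) \<le> 1"
      using exp_ge_add_one_self[of t] by (simp add: exp_minus field_simps)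
    ultimately show "\<exists>y. (f has_real_derivative y) (at t) \<and> 0 \<le> y"
      by (intro exI[of _ "1 - (1 + t) * exp (- t)"]) auto
  qed
  then have "2 - x \<le> (2 + x) / exp x"
    by (simp add: f_def exp_minus divide_inverse)
  then have "(2 - x) * exp x \<le> 2 + x"
    by (simp add: field_simps)
  then show ?thesis
    using assms by (simp add: field_simps)
qed

text \<open>For this \<open>l\<close> the Pade bound on \<open>exp l\<close> equals
  \<open>(1 + s) / s\<close>, hence \<open>exp l - 1 - l \<le> 1 / ((1 + 2 * s) * s)\<close>. After
  this substitution both sides coincide, so the estimate of \<open>exp l\<close> is the only
  loss.\<close>

lemma bernstein_tilt:
  fixes s \<epsilon> :: real
  assumes "0 < s" "0 < \<epsilon>"
  defines "l \<equiv> 2 / (1 + 2 * s)"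
  shows "(exp l - 1 - l) * (2 * \<epsilon> * s\<^sup>2) + \<epsilon> \<le> l * (2 * \<epsilon> * s + \<epsilon> / 2)"
proof -
  have l: "0 \<le> l" "l < 2" using assms by (auto simp: field_simps)
  have frac: "(2 + l) / (2 - l) = (1 + s) / s"
    using assms(1) by (simp add: l_def divide_simps)
  have "exp l \<le> (1 + s) / s"
    using exp_le_two_plus_over_two_minus[OF l] frac by simp
  then have "exp l - 1 - l \<le> (1 + s) / s - 1 - l" by simp
  also have "\<dots> = 1 / ((1 + 2 * s) * s)"
    using assms(1) by (simp add: l_def field_simps)
  finally have "(exp l - 1 - l) * (2 * \<epsilon> * s\<^sup>2) \<le> 1 / ((1 + 2 * s) * s) * (2 * \<epsilon> * s\<^sup>2)"
    using assms by (intro mult_right_mono) auto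
  also have "\<dots> = 2 * \<epsilon> * s / (1 + 2 * s)"
    using assms(1) by (simp add: power2_eq_square)
  also have "\<dots> + \<epsilon> = l * (2 * \<epsilon> * s + \<epsilon> / 2)"
    using assms(1) by (simp add: l_def field_simps)
  finally show ?thesis by simp
qed

text \<open>The tilt depends on \<open>v\<close> and \<open>\<epsilon>\<close> alone, so it can be
  fixed before the random values \<open>x\<close> and \<open>u\<close> are seen. Writing
  \<open>l * x - (exp l - 1) * u\<close> as \<open>l * (x - u) - (exp l - 1 - l) * u\<close> shows
  that \<open>u = v\<close> is the worst case, which is the previous lemma with
  \<open>v = 2 * \<epsilon> * s\<^sup>2\<close>.\<close>

lemma bernstein_tilt_crossing:
  fixes v \<epsilon> :: real
  assumes "0 < v" "0 < \<epsilon>"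
  obtains l where "0 \<le> l"
    "\<And>x u. 0 \<le> u \<Longrightarrow> u \<le> v \<Longrightarrow> u + sqrt (2 * v * \<epsilon>) + \<epsilon> / 2 \<le> x \<Longrightarrow>
       \<epsilon> \<le> l * x - (exp l - 1) * u"
proof -
  define s where "s = sqrt (v / (2 * \<epsilon>))"
  define l where "l = 2 / (1 + 2 * s)"
  have s: "0 < s" using assms by (simp add: s_def)
  have l: "0 \<le> l" using s by (simp add: l_def)
  have v: "v = 2 * \<epsilon> * s\<^sup>2" using assms by (simp add: s_def)
  have root: "sqrt (2 * v * \<epsilon>) = 2 * \<epsilon> * s"
    using assms s by (intro real_sqrt_unique) (auto simp: v power2_eq_square)
  show thesis
  proof (rule that[OF l])
    fix x u :: real
    assume u: "0 \<le> u" "u \<le> v" and x: "u + sqrt (2 * v * \<epsilon>) + \<epsilon> / 2 \<le> x"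
    have "0 \<le> exp l - 1 - l" using exp_ge_add_one_self[of l] by linarith
    then have "(exp l - 1 - l) * u + \<epsilon> \<le> (exp l - 1 - l) * v + \<epsilon>"
      using u by (intro add_right_mono mult_left_mono)
    also have "\<dots> \<le> l * (2 * \<epsilon> * s + \<epsilon> / 2)"
      using bernstein_tilt[OF s assms(2)] unfolding l_def v .
    also have "\<dots> \<le> l * (x - u)"
      using x root l by (intro mult_left_mono) auto
    finally show "\<epsilon> \<le> l * x - (exp l - 1) * u"
      by (simp add: algebra_simps)
  qed
qed

section \<open>From dyadic scales to the boundary \<open>freed_Delta\<close>\<close>

text \<open>With \<open>j\<close> the integer part of log2 (max u 1), the upper end of the dyadic
  cell covers \<open>u\<close>, the lower end bounds the price of rounding, and ln (j + 1) is at
  most ln (1 + log2 (max u 1)). This explains the shape of \<open>freed_eps\<close>.\<close>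

lemma freed_eps_dyadic:
  assumes "0 < \<delta>" "\<delta> < 1" "0 \<le> u"
  obtains j :: nat where "u \<le> 2 ^ (j + 1)"
    "sqrt (2 * 2 ^ (j + 1) * ln ((1 + freed_kappa) * (real j + 1)\<^sup>2 / \<delta>))
       + ln ((1 + freed_kappa) * (real j + 1)\<^sup>2 / \<delta>) / 2 \<le> freed_Delta \<delta> u"
proof -
  define m where "m = max u 1"
  define L where "L = log 2 m"
  define j where "j = nat \<lfloor>L\<rfloor>"
  define \<epsilon> where "\<epsilon> = ln ((1 + freed_kappa) * (real j + 1)\<^sup>2 / \<delta>)"
  have m: "1 \<le> m" by (simp add: m_def)
  then have L0: "0 \<le> L" by (simp add: L_def)
  then have j: "real j \<le> L" "L < real j + 1" by (auto simp: j_def)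
  have mL: "m = 2 powr L" using m by (simp add: L_def)
  have lower: "2 ^ j \<le> m"
    using j(1) by (simp add: mL powr_realpow[symmetric])
  have "m \<le> 2 powr (real (j + 1))"
    using j(2) unfolding mL by (intro powr_mono) auto
  then have "m \<le> 2 ^ (j + 1)" by (subst (asm) powr_realpow) auto
  then have upper: "u \<le> 2 ^ (j + 1)" by (simp add: m_def)
  have kappa: "0 < freed_kappa" by (simp add: freed_kappa_def)
  have "\<epsilon> = ln ((1 + freed_kappa) / \<delta> * (real j + 1)\<^sup>2)" by (simp add: \<epsilon>_def)
  also have "\<dots> = ln ((1 + freed_kappa) / \<delta>) + 2 * ln (real j + 1)"
    using kappa assms by (subst ln_mult) (auto simp: ln_realpow)
  finally have eps: "\<epsilon> = ln ((1 + freed_kappa) / \<delta>) + 2 * ln (real j + 1)" .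
  have le: "\<epsilon> \<le> freed_eps \<delta> u"
    using j(1) unfolding eps freed_eps_def m_def[symmetric] L_def[symmetric]
    by (simp add: add.commute)
  have "0 \<le> ln ((1 + freed_kappa) / \<delta>)"
    using kappa assms by (intro ln_ge_zero) (simp add: field_simps)
  then have eps0: "0 \<le> \<epsilon>" unfolding eps by simp
  \<comment> \<open>Here \<open>2 * 2 ^ (j + 1)\<close> is \<open>4 * 2 ^ j\<close> and
    \<open>2 ^ j \<le> m\<close>. The root of this 4 is the leading factor 2 of
    \<open>freed_Delta\<close>.\<close>
  have "2 * 2 ^ (j + 1) * \<epsilon> \<le> 4 * (m * freed_eps \<delta> u)"
    using mult_mono[OF lower le] m eps0 by simp
  then have "sqrt (2 * 2 ^ (j + 1) * \<epsilon>) \<le> sqrt (4 * (m * freed_eps \<delta> u))"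
    by simp
  also have "\<dots> = 2 * sqrt (freed_eps \<delta> u) * sqrt (max u 1)"
    by (simp add: real_sqrt_mult m_def mult_ac)
  finally have "sqrt (2 * 2 ^ (j + 1) * \<epsilon>) + \<epsilon> / 2 \<le> freed_Delta \<delta> u"
    using le by (simp add: freed_Delta_def)
  then show thesis
    using that upper unfolding \<epsilon>_def by blast
qed

lemma freed_Delta_measurable: "freed_Delta \<delta> \<in> borel_measurable borel"
  unfolding freed_Delta_def[abs_def] freed_eps_def[abs_def] by measurable

section \<open>Ville's maximal inequality\<close>

text \<open>The process is stopped when it first reaches \<open>c\<close> and its value is then
  replaced by \<open>c\<close>; the expectation of this modified process is at most that of
  \<open>X 0\<close>. The supermartingale property is stated through integrals over sets of
  \<open>F k\<close>, which is all that the stopping argument uses.\<close>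

lemma (in prob_space) ville_inequality_finite:
  fixes X :: "nat \<Rightarrow> 'a \<Rightarrow> real"
  assumes subalg: "\<And>k. subalgebra M (F k)"
    and filtration: "\<And>j k. j \<le> k \<Longrightarrow> sets (F j) \<subseteq> sets (F k)"
    and adapted: "\<And>k. X k \<in> borel_measurable (F k)"
    and integrable: "\<And>k. integrable M (X k)"
    and supermartingale: "\<And>k A. A \<in> sets (F k) \<Longrightarrow>
      (\<integral>\<omega>. indicator A \<omega> * X (Suc k) \<omega> \<partial>M) \<le> (\<integral>\<omega>. indicator A \<omega> * X k \<omega> \<partial>M)"
    and nonneg: "\<And>k \<omega>. \<omega> \<in> space M \<Longrightarrow> 0 \<le> X k \<omega>"
  shows "c * \<P>(\<omega> in M. \<exists>k\<le>n. c \<le> X k \<omega>) \<le> expectation (X 0)"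
proof -
  define C where "C n = {\<omega> \<in> space M. \<exists>k\<le>n. c \<le> X k \<omega>}" for n
  have C_iff: "\<omega> \<in> C n \<longleftrightarrow> \<omega> \<in> space M \<and> (\<exists>k\<le>n. c \<le> X k \<omega>)" for \<omega> n
    by (simp add: C_def)
  have space_F: "space (F k) = space M" for k
    using subalg[of k] by (simp add: subalgebra_def)
  have meas_F: "X k \<in> borel_measurable (F n)" if "k \<le> n" for k n
    using adapted[of k] filtration[OF that] space_F
    by (auto simp: measurable_def)
  have C_F: "C n \<in> sets (F n)" for n
  proof -
    have "{\<omega> \<in> space (F n). c \<le> X k \<omega>} \<in> sets (F n)" if "k \<le> n" for k
      using meas_F[OF that] by measurable
    then have "(\<Union>k\<in>{..n}. {\<omega> \<in> space (F n). c \<le> X k \<omega>}) \<in> sets (F n)"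
      by (intro sets.finite_UN) auto
    also have "(\<Union>k\<in>{..n}. {\<omega> \<in> space (F n). c \<le> X k \<omega>}) = C n"
      by (auto simp: C_def space_F)
    finally show ?thesis .
  qed
  then have [measurable]: "C n \<in> sets M" for n
    using subalg[of n] by (auto simp: subalgebra_def)
  have comp_F: "space M - C n \<in> sets (F n)" for n
    using sets.compl_sets[OF C_F[of n]] by (simp add: space_F)
  have [simp]: "integrable M (indicat_real (C n))" for n
    by (intro integrable_real_indicator) (auto simp: less_top[symmetric])
  have [simp]: "integrable M (\<lambda>\<omega>. indicator (space M - C n) \<omega> * X k \<omega>)" for n k
    using integrable_mult_indicator[OF _ integrable[of k], of "space M - C n"] by simp
  \<comment> \<open>The left side is the expectation of the stopped process at time
    \<open>n\<close>: \<open>c\<close> on paths that have crossed, \<open>X n\<close> on the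
    others.\<close>
  have stopped:
    "c * prob (C n) + (\<integral>\<omega>. indicator (space M - C n) \<omega> * X n \<omega> \<partial>M) \<le> expectation (X 0)" for n
  proof (induction n)
    case 0
    have "c * prob (C 0) + (\<integral>\<omega>. indicator (space M - C 0) \<omega> * X 0 \<omega> \<partial>M)
      = (\<integral>\<omega>. c * indicator (C 0) \<omega> + indicator (space M - C 0) \<omega> * X 0 \<omega> \<partial>M)"
      by (subst Bochner_Integration.integral_add) auto
    also have "\<dots> \<le> expectation (X 0)"
      by (intro integral_mono Bochner_Integration.integrable_add integrable)
         (auto simp: C_iff split: split_indicator)
    finally show ?case .
  next
    case (Suc n)
    have "c * prob (C (Suc n)) + (\<integral>\<omega>. indicator (space M - C (Suc n)) \<omega> * X (Suc n) \<omega> \<partial>M)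
      = (\<integral>\<omega>. c * indicator (C (Suc n)) \<omega> + indicator (space M - C (Suc n)) \<omega> * X (Suc n) \<omega> \<partial>M)"
      by (subst Bochner_Integration.integral_add) auto
    \<comment> \<open>A path that first crosses at time \<open>Suc n\<close> has
      \<open>c \<le> X (Suc n) \<omega>\<close>, so its value \<open>c\<close> may be raised to
      \<open>X (Suc n) \<omega>\<close>. What remains lives on the complement of \<open>C n\<close>,
      a set of \<open>F n\<close>, where the supermartingale inequality applies.\<close>
    also have "\<dots> \<le> (\<integral>\<omega>. c * indicator (C n) \<omega> + indicator (space M - C n) \<omega> * X (Suc n) \<omega> \<partial>M)"
      by (intro integral_mono Bochner_Integration.integrable_add)
         (auto simp: C_iff le_Suc_eq split: split_indicator)
    also have "\<dots> = c * prob (C n) + (\<integral>\<omega>. indicator (space M - C n) \<omega> * X (Suc n) \<omega> \<partial>M)"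
      by (subst Bochner_Integration.integral_add) auto
    also have "\<dots> \<le> c * prob (C n) + (\<integral>\<omega>. indicator (space M - C n) \<omega> * X n \<omega> \<partial>M)"
      using supermartingale[OF comp_F[of n]] by simp
    also have "\<dots> \<le> expectation (X 0)" by (rule Suc)
    finally show ?case .
  qed
  have "0 \<le> (\<integral>\<omega>. indicator (space M - C n) \<omega> * X n \<omega> \<partial>M)"
    by (intro integral_nonneg_AE) (auto simp: nonneg)
  then have "c * prob (C n) \<le> expectation (X 0)"
    using stopped[of n] by linarith
  then show ?thesis by (simp add: C_def)
qed

text \<open>The finite-horizon bound does not depend on \<open>n\<close>, so it survives continuity
  from below along the increasing events \<open>C n\<close>.\<close>

lemma (in prob_space) ville_inequality:
  fixes X :: "nat \<Rightarrow> 'a \<Rightarrow> real"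
  assumes subalg: "\<And>k. subalgebra M (F k)"
    and "\<And>j k. j \<le> k \<Longrightarrow> sets (F j) \<subseteq> sets (F k)"
    and adapted: "\<And>k. X k \<in> borel_measurable (F k)"
    and "\<And>k. integrable M (X k)"
    and "\<And>k A. A \<in> sets (F k) \<Longrightarrow>
      (\<integral>\<omega>. indicator A \<omega> * X (Suc k) \<omega> \<partial>M) \<le> (\<integral>\<omega>. indicator A \<omega> * X k \<omega> \<partial>M)"
    and "\<And>k \<omega>. \<omega> \<in> space M \<Longrightarrow> 0 \<le> X k \<omega>"
  shows "c * \<P>(\<omega> in M. \<exists>k. c \<le> X k \<omega>) \<le> expectation (X 0)"
proof -
  have [measurable]: "X k \<in> borel_measurable M" for k
    using measurable_from_subalg[OF subalg adapted] .
  define C where "C n = {\<omega> \<in> space M. \<exists>k\<le>n. c \<le> X k \<omega>}" for n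
  have "(\<lambda>n. prob (C n)) \<longlonglongrightarrow> prob (\<Union>n. C n)"
    by (intro finite_Lim_measure_incseq) (auto simp: C_def incseq_def intro: order_trans)
  then have "(\<lambda>n. c * prob (C n)) \<longlonglongrightarrow> c * prob (\<Union>n. C n)"
    by (rule tendsto_mult_left)
  moreover have "c * prob (C n) \<le> expectation (X 0)" for n
    unfolding C_def by (rule ville_inequality_finite[of F X c n, OF assms])
  ultimately have "c * prob (\<Union>n. C n) \<le> expectation (X 0)"
    by (intro LIMSEQ_le_const2) auto
  also have "(\<Union>n. C n) = {\<omega> \<in> space M. \<exists>k. c \<le> X k \<omega>}"
    by (auto simp: C_def)
  finally show ?thesis .
qed

section \<open>Conditional super-uniformity at a random predictable threshold\<close>

text \<open>
  The exceptional null set of the hypothesis depends on the level, so a random threshold cannot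
  simply be substituted; rounding it up to a finite grid leaves finitely many null sets.
\<close>

lemma (in prob_space) conditional_super_uniform_random_threshold:
  fixes q a W :: "'a \<Rightarrow> real"
  assumes subalg: "subalgebra M F"
    and q[measurable]: "q \<in> borel_measurable M"
    and super: "\<And>x. x \<in> {0..1} \<Longrightarrow>
      AE \<omega> in M. real_cond_exp M F (indicat_real {\<omega>. q \<omega> \<le> x}) \<omega> \<le> x"
    and a: "a \<in> borel_measurable F" and a01: "\<And>\<omega>. \<omega> \<in> space M \<Longrightarrow> a \<omega> \<in> {0..1}"
    and W: "W \<in> borel_measurable F" and W0: "\<And>\<omega>. \<omega> \<in> space M \<Longrightarrow> 0 \<le> W \<omega>"
    and WB: "\<And>\<omega>. \<omega> \<in> space M \<Longrightarrow> W \<omega> \<le> B"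
  shows "(\<integral>\<omega>. W \<omega> * of_bool (q \<omega> \<le> a \<omega>) \<partial>M) \<le> (\<integral>\<omega>. W \<omega> * a \<omega> \<partial>M)"
proof -
  interpret finite_measure_subalgebra M F
    using subalg by unfold_locales
  have [measurable]: "a \<in> borel_measurable M" "W \<in> borel_measurable M"
    using a W measurable_from_subalg[OF subalg] by auto
  note a[measurable] W[measurable]
  have bounded_int: "integrable M (\<lambda>\<omega>. W \<omega> * g \<omega>)"
    if [measurable]: "g \<in> borel_measurable M" and "\<And>\<omega>. \<omega> \<in> space M \<Longrightarrow> \<bar>g \<omega>\<bar> \<le> K" for g K
  proof (rule integrable_const_bound[of _ "B * K"])
    show "AE \<omega> in M. norm (W \<omega> * g \<omega>) \<le> B * K"
    proof (rule AE_I2)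
      fix \<omega> assume "\<omega> \<in> space M"
      then show "norm (W \<omega> * g \<omega>) \<le> B * K"
        using W0[of \<omega>] WB[of \<omega>] that(2)[of \<omega>] by (auto simp: abs_mult intro!: mult_mono)
    qed
  qed auto
  \<comment> \<open>At a fixed level there is a single null set. The weight
    \<open>W * of_bool P\<close> is \<open>F\<close>-measurable, so it can be moved past the
    conditional expectation.\<close>
  have level: "(\<integral>\<omega>. W \<omega> * of_bool (P \<omega>) * of_bool (q \<omega> \<le> x) \<partial>M)
      \<le> (\<integral>\<omega>. W \<omega> * of_bool (P \<omega>) * x \<partial>M)"
    if x: "x \<in> {0..1}" and P[measurable]: "Measurable.pred F P" for x P
  proof -
    have PM[measurable]: "Measurable.pred M P"
      using measurable_from_subalg[OF subalg P] .
    define g where "g = indicat_real {\<omega>. q \<omega> \<le> x}"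
    have g_eq: "g \<omega> = of_bool (q \<omega> \<le> x)" for \<omega> by (simp add: g_def indicator_def)
    have [measurable]: "g \<in> borel_measurable M" unfolding g_eq[abs_def] by measurable
    have i: "integrable M (\<lambda>\<omega>. (W \<omega> * of_bool (P \<omega>)) * g \<omega>)"
      unfolding mult.assoc by (rule bounded_int[of _ 1]) (auto simp: g_eq)
    have "(\<integral>\<omega>. (W \<omega> * of_bool (P \<omega>)) * g \<omega> \<partial>M)
        = (\<integral>\<omega>. (W \<omega> * of_bool (P \<omega>)) * real_cond_exp M F g \<omega> \<partial>M)"
      by (rule real_cond_exp_intg(2)[symmetric]) (use i in auto)
    also have "\<dots> \<le> (\<integral>\<omega>. W \<omega> * of_bool (P \<omega>) * x \<partial>M)"
    proof (rule integral_mono_AE)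
      show "integrable M (\<lambda>\<omega>. (W \<omega> * of_bool (P \<omega>)) * real_cond_exp M F g \<omega>)"
        by (rule real_cond_exp_intg(1)) (use i in auto)
      show "integrable M (\<lambda>\<omega>. W \<omega> * of_bool (P \<omega>) * x)"
        unfolding mult.assoc by (rule bounded_int[of _ "\<bar>x\<bar>"]) auto
      show "AE \<omega> in M. W \<omega> * of_bool (P \<omega>) * real_cond_exp M F g \<omega> \<le> W \<omega> * of_bool (P \<omega>) * x"
        using super[OF x] unfolding g_def[symmetric]
        by (rule AE_mp) (auto intro!: AE_I2 mult_left_mono simp: W0)
    qed
    finally show ?thesis by (simp add: g_eq)
  qed
  have grid: "(\<integral>\<omega>. W \<omega> * of_bool (q \<omega> \<le> a \<omega>) \<partial>M)
      \<le> (\<integral>\<omega>. W \<omega> * a \<omega> \<partial>M) + (\<integral>\<omega>. W \<omega> \<partial>M) * inverse (real (Suc n))" for n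
  proof -
    \<comment> \<open>\<open>h\<close> is the number j of the cell ((j - 1) / (n + 1), j / (n + 1)]
      containing \<open>a\<close>, and \<open>x j\<close> is its right end point. It inherits
      \<open>F\<close>-measurability from \<open>a\<close>.\<close>
    define h where "h \<omega> = \<lceil>a \<omega> * real (Suc n)\<rceil>" for \<omega>
    define x where "x j = real j / real (Suc n)" for j :: nat
    have h_meas: "Measurable.pred F (\<lambda>\<omega>. h \<omega> = int j)" for j
      unfolding h_def by measurable
    then have h_measM[measurable]: "Measurable.pred M (\<lambda>\<omega>. h \<omega> = int j)" for j
      using measurable_from_subalg[OF subalg] by blast
    \<comment> \<open>The last conjunct says that the cell indicators select exactly one summand. It
      lets an integrand with a random grid point be written as a finite sum over fixed
      levels.\<close>
    have cases: "\<exists>j\<in>{..Suc n}. h \<omega> = int j \<and> a \<omega> \<le> x j \<and> x j \<le> a \<omega> + inverse (real (Suc n))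
        \<and> (\<forall>f :: nat \<Rightarrow> real. (\<Sum>i\<le>Suc n. of_bool (h \<omega> = int i) * f i) = f j)"
      if \<omega>: "\<omega> \<in> space M" for \<omega>
    proof -
      have a: "0 \<le> a \<omega>" "a \<omega> \<le> 1" using a01[OF \<omega>] by auto
      have h0: "0 \<le> h \<omega>"
        using a unfolding h_def by (metis ceiling_mono ceiling_zero mult_nonneg_nonneg of_nat_0_le_iff)
      have "a \<omega> * real (Suc n) \<le> of_int (int (Suc n))"
        using a mult_right_mono[of "a \<omega>" 1 "real (Suc n)"] by simp
      then have h1: "h \<omega> \<le> int (Suc n)" unfolding h_def by (rule ceiling_le)
      define j where "j = nat (h \<omega>)"
      have j: "h \<omega> = int j" using h0 by (simp add: j_def)
      have up: "a \<omega> * real (Suc n) \<le> real j" "real j \<le> a \<omega> * real (Suc n) + 1"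
        using j unfolding h_def by linarith+
      have "a \<omega> \<le> x j"
        using up(1) by (simp add: x_def pos_le_divide_eq del: of_nat_Suc)
      moreover have "x j \<le> (a \<omega> * real (Suc n) + 1) / real (Suc n)"
        unfolding x_def using up(2) by (intro divide_right_mono) auto
      then have "x j \<le> a \<omega> + inverse (real (Suc n))"
        by (simp add: add_divide_distrib inverse_eq_divide del: of_nat_Suc)
      moreover have "(\<Sum>i\<le>Suc n. of_bool (h \<omega> = int i) * f i) = f j" for f :: "nat \<Rightarrow> real"
      proof -
        have "(\<Sum>i\<le>Suc n. of_bool (h \<omega> = int i) * f i) = (\<Sum>i\<le>Suc n. if i = j then f i else 0)"
          by (rule sum.cong) (auto simp: j)
        also have "\<dots> = f j" using j h1 by (subst sum.delta) auto
        finally show ?thesis .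
      qed
      ultimately show ?thesis using j h1 by (intro bexI[of _ j]) auto
    qed
    have int1: "integrable M (\<lambda>\<omega>. W \<omega> * of_bool (h \<omega> = int j) * of_bool (q \<omega> \<le> x j))" for j
      unfolding mult.assoc by (rule bounded_int[of _ 1]) auto
    have int2: "integrable M (\<lambda>\<omega>. W \<omega> * of_bool (h \<omega> = int j) * x j)" for j
      unfolding mult.assoc by (rule bounded_int[of _ "\<bar>x j\<bar>"]) auto
    have intW: "integrable M W" using bounded_int[of "\<lambda>_. 1" 1] by simp
    have intWa: "integrable M (\<lambda>\<omega>. W \<omega> * a \<omega>)"
      by (rule bounded_int[of _ 1]) (use a01 in auto)
    have "(\<integral>\<omega>. W \<omega> * of_bool (q \<omega> \<le> a \<omega>) \<partial>M)
        \<le> (\<integral>\<omega>. (\<Sum>j\<le>Suc n. W \<omega> * of_bool (h \<omega> = int j) * of_bool (q \<omega> \<le> x j)) \<partial>M)"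
    proof (rule integral_mono)
      fix \<omega> assume \<omega>: "\<omega> \<in> space M"
      obtain j where j: "a \<omega> \<le> x j"
        "\<And>f :: nat \<Rightarrow> real. (\<Sum>i\<le>Suc n. of_bool (h \<omega> = int i) * f i) = f j"
        using cases[OF \<omega>] by blast
      have "W \<omega> * of_bool (q \<omega> \<le> a \<omega>) \<le> W \<omega> * of_bool (q \<omega> \<le> x j)"
        using j(1) W0[OF \<omega>] by (intro mult_left_mono) auto
      then show "W \<omega> * of_bool (q \<omega> \<le> a \<omega>)
          \<le> (\<Sum>j\<le>Suc n. W \<omega> * of_bool (h \<omega> = int j) * of_bool (q \<omega> \<le> x j))"
        unfolding mult.assoc sum_distrib_left[symmetric] j(2) .
    qed (intro bounded_int[of _ 1] Bochner_Integration.integrable_sum int1; simp)+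
    also have "\<dots> = (\<Sum>j\<le>Suc n. \<integral>\<omega>. W \<omega> * of_bool (h \<omega> = int j) * of_bool (q \<omega> \<le> x j) \<partial>M)"
      by (rule Bochner_Integration.integral_sum) (rule int1)
    \<comment> \<open>On each cell the threshold is the constant \<open>x j\<close>, so
      \<open>level\<close> applies with the cell as \<open>P\<close>.\<close>
    also have "\<dots> \<le> (\<Sum>j\<le>Suc n. \<integral>\<omega>. W \<omega> * of_bool (h \<omega> = int j) * x j \<partial>M)"
      by (intro sum_mono level h_meas) (auto simp: x_def)
    also have "\<dots> = (\<integral>\<omega>. (\<Sum>j\<le>Suc n. W \<omega> * of_bool (h \<omega> = int j) * x j) \<partial>M)"
      by (rule Bochner_Integration.integral_sum[symmetric]) (rule int2)
    also have "\<dots> \<le> (\<integral>\<omega>. W \<omega> * a \<omega> + W \<omega> * inverse (real (Suc n)) \<partial>M)"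
    proof (rule integral_mono)
      fix \<omega> assume \<omega>: "\<omega> \<in> space M"
      obtain j where j: "x j \<le> a \<omega> + inverse (real (Suc n))"
        "\<And>f :: nat \<Rightarrow> real. (\<Sum>i\<le>Suc n. of_bool (h \<omega> = int i) * f i) = f j"
        using cases[OF \<omega>] by blast
      have "W \<omega> * x j \<le> W \<omega> * (a \<omega> + inverse (real (Suc n)))"
        using j(1) W0[OF \<omega>] by (intro mult_left_mono) auto
      then show "(\<Sum>j\<le>Suc n. W \<omega> * of_bool (h \<omega> = int j) * x j)
          \<le> W \<omega> * a \<omega> + W \<omega> * inverse (real (Suc n))"
        unfolding mult.assoc sum_distrib_left[symmetric] j(2) distrib_left .
    qed (intro Bochner_Integration.integrable_sum Bochner_Integration.integrable_add
        integrable_mult_left int2 intW intWa)+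
    also have "\<dots> = (\<integral>\<omega>. W \<omega> * a \<omega> \<partial>M) + (\<integral>\<omega>. W \<omega> \<partial>M) * inverse (real (Suc n))"
      using intW intWa by (subst Bochner_Integration.integral_add) auto
    finally show ?thesis .
  qed
  have "(\<lambda>n. (\<integral>\<omega>. W \<omega> * a \<omega> \<partial>M) + (\<integral>\<omega>. W \<omega> \<partial>M) * inverse (real (Suc n)))
      \<longlonglongrightarrow> (\<integral>\<omega>. W \<omega> * a \<omega> \<partial>M) + (\<integral>\<omega>. W \<omega> \<partial>M) * 0"
    by (intro tendsto_intros LIMSEQ_inverse_real_of_nat)
  then show ?thesis
    using grid by (intro LIMSEQ_le_const) auto
qed

section \<open>The testing model, its filtration and adaptedness\<close>

locale online_testing = prob_space M for M :: "'a measure" +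
  fixes p \<alpha> :: "nat \<Rightarrow> 'a \<Rightarrow> real" and H0 :: "nat set"
  assumes p_measurable: "\<And>k. k \<ge> 1 \<Longrightarrow> p k \<in> borel_measurable M"
    and procedure: "online_procedure M p \<alpha>"
    and super_uniform: "cond_super_uniform M H0 p \<alpha>"
begin

abbreviation "G \<equiv> rejection_sigma M p \<alpha>"

definition false_rejections :: "nat \<Rightarrow> 'a \<Rightarrow> real" where
  "false_rejections k \<omega> = (\<Sum>i=1..k. of_bool (i \<in> H0) * of_bool (p i \<omega> \<le> \<alpha> i \<omega>))"

definition spent_level :: "nat \<Rightarrow> 'a \<Rightarrow> real" where
  "spent_level k \<omega> = (\<Sum>i=1..k. \<alpha> i \<omega>)"

text \<open>The compensator is of Poisson type: \<open>1 + c * a \<le> exp (c * a)\<close> dominates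
  the Bernoulli moment generating function. Levels spent outside \<open>H0\<close> are included as
  well; for \<open>l \<ge> 0\<close> they only lower the process.\<close>

definition tilted :: "real \<Rightarrow> nat \<Rightarrow> 'a \<Rightarrow> real" where
  "tilted l k \<omega> = exp (l * false_rejections k \<omega> - (exp l - 1) * spent_level k \<omega>)"

lemma alpha_range: "k \<ge> 1 \<Longrightarrow> \<omega> \<in> space M \<Longrightarrow> 0 \<le> \<alpha> k \<omega> \<and> \<alpha> k \<omega> \<le> 1"
  using procedure by (auto simp: online_procedure_def)

lemma alpha_predictable: "\<alpha> (Suc k) \<in> borel_measurable (G k)"
  using procedure by (auto simp: online_procedure_def)

lemma space_G [simp]: "space (G k) = space M"
  by (simp add: rejection_sigma_def space_measure_of_conv)

lemma sets_G:
  "sets (G k) = sigma_sets (space M)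
     (\<Union>i\<in>{1..k}. {(indicat_real {\<omega>. p i \<omega> \<le> \<alpha> i \<omega>}) -` B \<inter> space M | B. B \<in> sets borel})"
  unfolding rejection_sigma_def by (rule sets_measure_of) auto

lemma G_mono: "j \<le> k \<Longrightarrow> sets (G j) \<subseteq> sets (G k)"
  unfolding sets_G by (rule sigma_sets_mono') (force simp: Bex_def)

lemma measurable_G_mono: "f \<in> borel_measurable (G j) \<Longrightarrow> j \<le> k \<Longrightarrow> f \<in> borel_measurable (G k)"
  using G_mono[of j k] by (auto simp: measurable_def)

text \<open>Strong induction resolves a circularity: the generators of \<open>G k\<close> involve
  \<open>\<alpha> i\<close> for \<open>i \<le> k\<close>, whose measurability is known only with
  respect to the earlier \<open>G (i - 1)\<close>.\<close>

lemma subalgebra_G: "subalgebra M (G k)"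
proof (induction k rule: less_induct)
  case (less k)
  have "indicat_real {\<omega>. p i \<omega> \<le> \<alpha> i \<omega>} \<in> borel_measurable M" if "i \<in> {1..k}" for i
  proof -
    obtain j where j: "i = Suc j" "j < k" using \<open>i \<in> {1..k}\<close> by (cases i) auto
    have [measurable]: "p i \<in> borel_measurable M" using p_measurable that by auto
    have [measurable]: "\<alpha> i \<in> borel_measurable M"
      unfolding j(1) using measurable_from_subalg[OF less[OF j(2)] alpha_predictable] .
    have "(\<lambda>\<omega>. of_bool (p i \<omega> \<le> \<alpha> i \<omega>) :: real) \<in> borel_measurable M" by measurable
    then show ?thesis by (simp add: indicator_def[abs_def])
  qed
  then have "sets (G k) \<subseteq> sets M"
    unfolding sets_G by (intro sets.sigma_sets_subset) (auto dest: measurable_sets)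
  then show ?case by (simp add: subalgebra_def)
qed

lemma alpha_measurable: "k \<ge> 1 \<Longrightarrow> \<alpha> k \<in> borel_measurable M"
  using measurable_from_subalg[OF subalgebra_G alpha_predictable, of "k - 1"] by simp

lemma rejection_adapted:
  assumes "1 \<le> i" "i \<le> k"
  shows "(\<lambda>\<omega>. of_bool (p i \<omega> \<le> \<alpha> i \<omega>) :: real) \<in> borel_measurable (G k)"
proof -
  have "indicat_real {\<omega>. p i \<omega> \<le> \<alpha> i \<omega>} \<in> borel_measurable (G k)"
  proof (rule measurableI)
    fix B :: "real set" assume "B \<in> sets borel"
    then show "indicat_real {\<omega>. p i \<omega> \<le> \<alpha> i \<omega>} -` B \<inter> space (G k) \<in> sets (G k)"
      unfolding sets_G space_G using assms by (intro sigma_sets.Basic UN_I[of i]) auto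
  qed auto
  then show ?thesis by (simp add: indicator_def[abs_def])
qed

lemma false_rejections_adapted: "false_rejections k \<in> borel_measurable (G k)"
  unfolding false_rejections_def[abs_def]
  by (intro borel_measurable_sum borel_measurable_times borel_measurable_const rejection_adapted) auto

lemma spent_level_adapted: "spent_level k \<in> borel_measurable (G k)"
  unfolding spent_level_def[abs_def]
proof (rule borel_measurable_sum)
  fix i assume "i \<in> {1..k}"
  then show "\<alpha> i \<in> borel_measurable (G k)"
    using measurable_G_mono[OF alpha_predictable, of "i - 1" k] by (cases i) auto
qed

section \<open>The exponential supermartingale\<close>

lemma tilted_pos: "0 < tilted l k \<omega>"
  by (simp add: tilted_def)

lemma tilted_adapted: "tilted l k \<in> borel_measurable (G k)"
  using false_rejections_adapted[of k] spent_level_adapted[of k]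
  unfolding tilted_def[abs_def] by measurable

lemma tilted_measurable [measurable]: "tilted l k \<in> borel_measurable M"
  using measurable_from_subalg[OF subalgebra_G tilted_adapted] .

lemma spent_level_nonneg: "\<omega> \<in> space M \<Longrightarrow> 0 \<le> spent_level k \<omega>"
  unfolding spent_level_def by (intro sum_nonneg) (use alpha_range in auto)

lemma false_rejections_le: "false_rejections k \<omega> \<le> real k"
proof -
  have "false_rejections k \<omega> \<le> (\<Sum>i=1..k. 1)"
    unfolding false_rejections_def by (intro sum_mono) auto
  then show ?thesis by simp
qed

lemma tilted_bound:
  assumes "0 \<le> l" "\<omega> \<in> space M"
  shows "tilted l k \<omega> \<le> exp (l * real k)"
proof -
  have "0 \<le> (exp l - 1) * spent_level k \<omega>"
    using assms spent_level_nonneg by simp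
  moreover have "l * false_rejections k \<omega> \<le> l * real k"
    using assms false_rejections_le by (intro mult_left_mono)
  ultimately show ?thesis by (simp add: tilted_def)
qed

lemma tilted_integrable: "0 \<le> l \<Longrightarrow> integrable M (tilted l k)"
  by (rule integrable_const_bound[of _ "exp (l * real k)"])
     (use tilted_bound in \<open>auto simp: tilted_def\<close>)

text \<open>One step multiplies the process by
  \<open>exp (l * \<xi> - c * \<alpha> (Suc k))\<close>. Since \<open>\<xi>\<close> is 0 or 1 the
  first exponential is affine in \<open>\<xi>\<close>; in the mean \<open>\<xi>\<close> may be
  replaced by \<open>\<alpha> (Suc k)\<close>, and \<open>1 + c * \<alpha> (Suc k)\<close> is
  absorbed by the compensator.\<close>

lemma tilted_supermartingale:
  assumes l: "0 \<le> l" and A: "A \<in> sets (G k)"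
  shows "(\<integral>\<omega>. indicator A \<omega> * tilted l (Suc k) \<omega> \<partial>M) \<le> (\<integral>\<omega>. indicator A \<omega> * tilted l k \<omega> \<partial>M)"
proof -
  define c where "c = exp l - 1"
  \<comment> \<open>\<open>W\<close> collects all factors known at time \<open>k\<close>, including
    the next compensator factor, which is predictable. It is nonnegative and bounded, as the
    random-threshold lemma requires.\<close>
  define W where "W \<omega> = indicator A \<omega> * tilted l k \<omega> * exp (- c * \<alpha> (Suc k) \<omega>)" for \<omega>
  define \<xi> :: "'a \<Rightarrow> real"
    where "\<xi> \<omega> = of_bool (Suc k \<in> H0) * of_bool (p (Suc k) \<omega> \<le> \<alpha> (Suc k) \<omega>)" for \<omega>
  have c: "0 \<le> c" using l by (simp add: c_def)
  have AM[measurable]: "A \<in> sets M" using A subalgebra_G by (auto simp: subalgebra_def)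
  have [measurable]: "p (Suc k) \<in> borel_measurable M" "\<alpha> (Suc k) \<in> borel_measurable M"
    using p_measurable alpha_measurable by auto
  have range: "0 \<le> \<alpha> (Suc k) \<omega>" "\<alpha> (Suc k) \<omega> \<le> 1" if "\<omega> \<in> space M" for \<omega>
    using alpha_range[of "Suc k" \<omega>] that by auto
  have WG: "W \<in> borel_measurable (G k)"
    using A alpha_predictable[of k] tilted_adapted[of l k] unfolding W_def[abs_def] by measurable
  have [measurable]: "W \<in> borel_measurable M" unfolding W_def[abs_def] by measurable
  have W0: "0 \<le> W \<omega>" for \<omega> by (simp add: W_def tilted_def)
  have W_le: "W \<omega> \<le> exp (l * real k)" if "\<omega> \<in> space M" for \<omega>
  proof -
    have "W \<omega> \<le> (1 * exp (l * real k)) * 1"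
      unfolding W_def using tilted_bound[OF l that] c range[OF that]
      by (intro mult_mono) (auto simp: tilted_def indicator_def)
    then show ?thesis by simp
  qed
  have int: "integrable M (\<lambda>\<omega>. W \<omega> * g \<omega>)"
    if [measurable]: "g \<in> borel_measurable M" and "\<And>\<omega>. \<omega> \<in> space M \<Longrightarrow> \<bar>g \<omega>\<bar> \<le> 1" for g
    by (rule integrable_const_bound[of _ "exp (l * real k)"])
       (use that(2) W_le W0 in \<open>auto intro!: AE_I2 simp: abs_mult mult_left_le order_trans[OF mult_left_le]\<close>)
  have xi_M[measurable]: "\<xi> \<in> borel_measurable M" unfolding \<xi>_def[abs_def] by measurable
  have intW: "integrable M W" using int[of "\<lambda>_. 1"] by simp
  have intx: "integrable M (\<lambda>\<omega>. W \<omega> * \<xi> \<omega>)" by (rule int) (auto simp: \<xi>_def)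
  have inta: "integrable M (\<lambda>\<omega>. W \<omega> * \<alpha> (Suc k) \<omega>)" by (rule int) (use range in auto)
  have step: "(\<integral>\<omega>. W \<omega> * \<xi> \<omega> \<partial>M) \<le> (\<integral>\<omega>. W \<omega> * \<alpha> (Suc k) \<omega> \<partial>M)"
  proof (cases "Suc k \<in> H0")
    case True
    have "AE \<omega> in M. real_cond_exp M (G k) (indicat_real {\<omega>. p (Suc k) \<omega> \<le> x}) \<omega> \<le> x"
      if "x \<in> {0..1}" for x
      using super_uniform True that by (force simp: cond_super_uniform_def)
    then have "(\<integral>\<omega>. W \<omega> * of_bool (p (Suc k) \<omega> \<le> \<alpha> (Suc k) \<omega>) \<partial>M)
        \<le> (\<integral>\<omega>. W \<omega> * \<alpha> (Suc k) \<omega> \<partial>M)"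
      using W_le W0 range
      by (intro conditional_super_uniform_random_threshold[OF subalgebra_G[of k], where B="exp (l * real k)"]
            alpha_predictable WG) auto
    then show ?thesis using True by (simp add: \<xi>_def)
  next
    case False
    \<comment> \<open>Without a true null at \<open>Suc k\<close> nothing is added to the false
      rejections: the left integral is 0 and the right one is nonnegative.\<close>
    then show ?thesis
      using W0 range by (auto simp: \<xi>_def intro!: integral_nonneg_AE AE_I2)
  qed
  have "indicator A \<omega> * tilted l (Suc k) \<omega> = W \<omega> + c * (W \<omega> * \<xi> \<omega>)" for \<omega>
  proof -
    \<comment> \<open>A function on {0, 1} is affine; its slope here is
      \<open>exp l - 1\<close>.\<close>
    have "exp (l * \<xi> \<omega>) = 1 + c * \<xi> \<omega>" by (simp add: \<xi>_def c_def)
    moreover have "tilted l (Suc k) \<omega> = tilted l k \<omega> * exp (- c * \<alpha> (Suc k) \<omega>) * exp (l * \<xi> \<omega>)"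
      unfolding tilted_def exp_add[symmetric]
      by (simp add: false_rejections_def spent_level_def \<xi>_def c_def algebra_simps)
    ultimately show ?thesis by (simp add: W_def algebra_simps)
  qed
  then have "(\<integral>\<omega>. indicator A \<omega> * tilted l (Suc k) \<omega> \<partial>M)
      = (\<integral>\<omega>. W \<omega> \<partial>M) + c * (\<integral>\<omega>. W \<omega> * \<xi> \<omega> \<partial>M)"
    using intW intx by simp
  also have "\<dots> \<le> (\<integral>\<omega>. W \<omega> \<partial>M) + c * (\<integral>\<omega>. W \<omega> * \<alpha> (Suc k) \<omega> \<partial>M)"
    using step c by (intro add_left_mono mult_left_mono)
  also have "\<dots> = (\<integral>\<omega>. W \<omega> + c * (W \<omega> * \<alpha> (Suc k) \<omega>) \<partial>M)"
    using intW inta by simp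
  also have "\<dots> \<le> (\<integral>\<omega>. indicator A \<omega> * tilted l k \<omega> \<partial>M)"
  proof (rule integral_mono)
    show "integrable M (\<lambda>\<omega>. indicator A \<omega> * tilted l k \<omega>)"
      using integrable_mult_indicator[OF AM tilted_integrable[OF l, of k]] by simp
    show "W \<omega> + c * (W \<omega> * \<alpha> (Suc k) \<omega>) \<le> indicator A \<omega> * tilted l k \<omega>" for \<omega>
    proof -
      have "W \<omega> + c * (W \<omega> * \<alpha> (Suc k) \<omega>) = W \<omega> * (1 + c * \<alpha> (Suc k) \<omega>)"
        by (simp add: algebra_simps)
      also have "\<dots> \<le> W \<omega> * exp (c * \<alpha> (Suc k) \<omega>)"
        using W0 exp_ge_add_one_self by (intro mult_left_mono) auto
      also have "\<dots> = indicator A \<omega> * tilted l k \<omega>"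
        by (simp add: W_def exp_minus)
      finally show ?thesis .
    qed
  qed (use intW inta in auto)
  finally show ?thesis .
qed

lemma tilted_crossing_prob:
  assumes "0 \<le> l"
  shows "\<P>(\<omega> in M. \<exists>k. exp \<epsilon> \<le> tilted l k \<omega>) \<le> exp (- \<epsilon>)"
proof -
  have "exp \<epsilon> * \<P>(\<omega> in M. \<exists>k. exp \<epsilon> \<le> tilted l k \<omega>) \<le> expectation (tilted l 0)"
    by (rule ville_inequality[where F=G])
       (simp_all add: assms subalgebra_G G_mono tilted_adapted tilted_integrable
          tilted_supermartingale tilted_pos less_imp_le)
  also have "expectation (tilted l 0) = 1"
    by (simp add: tilted_def[abs_def] false_rejections_def spent_level_def prob_space)
  finally show ?thesis by (simp add: exp_minus field_simps)
qed

section \<open>Rejection counts and measurability of the two FDP quantities\<close>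

lemma rejections_card_eq: "real (card (rejections p \<alpha> k \<omega>)) = (\<Sum>i=1..k. of_bool (p i \<omega> \<le> \<alpha> i \<omega>))"
proof -
  have "rejections p \<alpha> k \<omega> = {1..k} \<inter> {i. p i \<omega> \<le> \<alpha> i \<omega>}" by (auto simp: rejections_def)
  then show ?thesis by (simp add: sum_of_bool_eq)
qed

lemma false_rejections_card_eq: "real (card (rejections p \<alpha> k \<omega> \<inter> H0)) = false_rejections k \<omega>"
proof -
  have "rejections p \<alpha> k \<omega> \<inter> H0 = {1..k} \<inter> {i. i \<in> H0 \<and> p i \<omega> \<le> \<alpha> i \<omega>}"
    by (auto simp: rejections_def)
  then show ?thesis
    by (simp add: false_rejections_def of_bool_conj[symmetric] sum_of_bool_eq)
qed

lemma false_rejections_measurable: "false_rejections k \<in> borel_measurable M"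
  using measurable_from_subalg[OF subalgebra_G false_rejections_adapted] .

lemma spent_level_measurable: "spent_level k \<in> borel_measurable M"
  using measurable_from_subalg[OF subalgebra_G spent_level_adapted] .

lemma rejections_card_measurable:
  "(\<lambda>\<omega>. real (card (rejections p \<alpha> k \<omega>))) \<in> borel_measurable M"
  unfolding rejections_card_eq
  by (intro borel_measurable_sum measurable_from_subalg[OF subalgebra_G rejection_adapted]) auto

lemma FDP_measurable: "(\<lambda>\<omega>. FDP H0 (rejections p \<alpha> k \<omega>)) \<in> borel_measurable M"
  unfolding FDP_def false_rejections_card_eq
  by (intro borel_measurable_divide borel_measurable_max borel_measurable_const
      false_rejections_measurable rejections_card_measurable)

lemma FDP_bar_Freed_measurable: "FDP_bar_Freed \<delta> p \<alpha> k \<in> borel_measurable M"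
  unfolding FDP_bar_Freed_def[abs_def] spent_level_def[symmetric]
  by (intro borel_measurable_min borel_measurable_divide borel_measurable_add borel_measurable_max
      borel_measurable_const rejections_card_measurable spent_level_measurable
      measurable_compose[OF spent_level_measurable freed_Delta_measurable])

section \<open>Union bound over the dyadic scales\<close>

text \<open>One exceptional event serves all times \<open>k\<close>. Outside it no tilted process of
  any scale crosses its level, so the scale may be picked afterwards, depending on both
  \<open>\<omega>\<close> and \<open>k\<close>.\<close>

lemma false_rejections_bound:
  assumes \<delta>: "0 < \<delta>" "\<delta> < 1"
  obtains B where "B \<in> sets M" "prob B \<le> \<delta>"
    "\<And>\<omega> k. \<omega> \<in> space M - B \<Longrightarrow>
       false_rejections k \<omega> \<le> spent_level k \<omega> + freed_Delta \<delta> (spent_level k \<omega>)"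
proof -
  define K where "K = 1 + freed_kappa"
  define \<epsilon> where "\<epsilon> j = ln (K * (real j + 1)\<^sup>2 / \<delta>)" for j
  have kappa: "0 < freed_kappa" by (simp add: freed_kappa_def)
  have K: "1 < K" using kappa by (simp add: K_def)
  have arg: "1 < K * (real j + 1)\<^sup>2 / \<delta>" for j
  proof -
    have "K * 1 \<le> K * (real j + 1)\<^sup>2" using K by (intro mult_left_mono one_le_power) auto
    then have "\<delta> < K * (real j + 1)\<^sup>2" using K \<delta> by linarith
    then show ?thesis using \<delta> by (simp add: less_divide_eq)
  qed
  then have eps: "0 < \<epsilon> j" for j unfolding \<epsilon>_def by (rule ln_gt_zero)
  have exp_eps: "exp (- \<epsilon> j) = \<delta> / K * (1 / (real j + 1)\<^sup>2)" for j
    using arg[of j] by (simp add: \<epsilon>_def exp_minus)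
  \<comment> \<open>The existential form permits a simultaneous choice of one deterministic tilt per
    scale.\<close>
  have "\<exists>l\<ge>0. \<forall>x u. 0 \<le> u \<longrightarrow> u \<le> 2 ^ (j + 1) \<longrightarrow>
      u + sqrt (2 * 2 ^ (j + 1) * \<epsilon> j) + \<epsilon> j / 2 \<le> x \<longrightarrow> \<epsilon> j \<le> l * x - (exp l - 1) * u" for j
    by (rule bernstein_tilt_crossing[of "2 ^ (j + 1)" "\<epsilon> j"]) (use eps in auto)
  then obtain l where l: "\<And>j. 0 \<le> l j"
    and cross: "\<And>j x u. 0 \<le> u \<Longrightarrow> u \<le> 2 ^ (j + 1) \<Longrightarrow>
      u + sqrt (2 * 2 ^ (j + 1) * \<epsilon> j) + \<epsilon> j / 2 \<le> x \<Longrightarrow> \<epsilon> j \<le> l j * x - (exp (l j) - 1) * u"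
    by metis
  define B where "B j = {\<omega> \<in> space M. \<exists>k. exp (\<epsilon> j) \<le> tilted (l j) k \<omega>}" for j
  have BM: "B j \<in> sets M" for j unfolding B_def by measurable
  have PB: "prob (B j) \<le> exp (- \<epsilon> j)" for j
    unfolding B_def by (rule tilted_crossing_prob[OF l])
  \<comment> \<open>This is the Basel sum, the origin of the constant
    \<open>freed_kappa\<close>.\<close>
  have "(\<lambda>j. \<delta> / K * (1 / (real j + 1)\<^sup>2)) sums (\<delta> / K * freed_kappa)"
    unfolding freed_kappa_def using inverse_squares_sums by (intro sums_mult) (simp add: add.commute)
  then have sums: "(\<lambda>j. exp (- \<epsilon> j)) sums (\<delta> / K * freed_kappa)" by (simp add: exp_eps)
  have summ: "summable (\<lambda>j. prob (B j))"
    by (rule summable_comparison_test'[OF sums_summable[OF sums], of 0]) (use PB in auto)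
  have "prob (\<Union>j. B j) \<le> (\<Sum>j. prob (B j))"
    by (rule finite_measure_subadditive_countably) (use BM summ in auto)
  also have "\<dots> \<le> (\<Sum>j. exp (- \<epsilon> j))"
    by (rule suminf_le) (use PB summ sums in \<open>auto intro: sums_summable\<close>)
  also have "\<dots> = \<delta> / K * freed_kappa" using sums by (rule sums_unique[symmetric])
  also have "\<dots> \<le> \<delta>" using \<delta> kappa by (simp add: K_def field_simps)
  finally have prob: "prob (\<Union>j. B j) \<le> \<delta>" .
  show thesis
  proof (rule that[of "\<Union>j. B j"])
    show "(\<Union>j. B j) \<in> sets M" using BM by auto
    show "prob (\<Union>j. B j) \<le> \<delta>" by (rule prob)
    fix \<omega> k assume \<omega>: "\<omega> \<in> space M - (\<Union>j. B j)"
    define u where "u = spent_level k \<omega>"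
    have u: "0 \<le> u" using spent_level_nonneg \<omega> by (simp add: u_def)
    obtain j where j: "u \<le> 2 ^ (j + 1)"
      "sqrt (2 * 2 ^ (j + 1) * \<epsilon> j) + \<epsilon> j / 2 \<le> freed_Delta \<delta> u"
      using freed_eps_dyadic[OF \<delta> u] unfolding \<epsilon>_def K_def by blast
    show "false_rejections k \<omega> \<le> spent_level k \<omega> + freed_Delta \<delta> (spent_level k \<omega>)"
    proof (rule ccontr)
      assume "\<not> ?thesis"
      \<comment> \<open>A violation of the bound exceeds the Bernstein boundary of scale
        \<open>j\<close>, hence forces the tilted process of that scale to cross at time
        \<open>k\<close>.\<close>
      then have "\<epsilon> j \<le> l j * false_rejections k \<omega> - (exp (l j) - 1) * u"
        using j u by (intro cross) (auto simp: u_def)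
      then have "exp (\<epsilon> j) \<le> tilted (l j) k \<omega>" by (simp add: tilted_def u_def)
      then show False using \<omega> by (auto simp: B_def)
    qed
  qed
qed

end

section \<open>From counts of false rejections to the FDP envelope\<close>

theorem theorem26:
  fixes M :: "'a measure"
    and p \<alpha> :: "nat \<Rightarrow> 'a \<Rightarrow> real"
    and H0 :: "nat set"
    and \<delta> :: real
  assumes "prob_space M"
    and "\<And>k. k \<ge> 1 \<Longrightarrow> p k \<in> borel_measurable M"
    and "\<And>k \<omega>. k \<ge> 1 \<Longrightarrow> \<omega> \<in> space M \<Longrightarrow> p k \<omega> \<in> {0..1}"
    and "H0 \<subseteq> {1..}"
    and "online_procedure M p \<alpha>"
    and "cond_super_uniform M H0 p \<alpha>"
    and "0 < \<delta>" and "\<delta> < 1"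
  shows "\<P>(\<omega> in M. \<forall>k\<ge>1. FDP H0 (rejections p \<alpha> k \<omega>) \<le> FDP_bar_Freed \<delta> p \<alpha> k \<omega>) \<ge> 1 - \<delta>"
proof -
  interpret prob_space M by fact
  interpret online_testing M p \<alpha> H0 by unfold_locales (use assms in auto)
  obtain B where B: "B \<in> sets M" "prob B \<le> \<delta>"
    and bound: "\<And>\<omega> k. \<omega> \<in> space M - B \<Longrightarrow>
       false_rejections k \<omega> \<le> spent_level k \<omega> + freed_Delta \<delta> (spent_level k \<omega>)"
    using false_rejections_bound[OF assms(7,8)] by blast
  define good where
    "good = {\<omega> \<in> space M. \<forall>k\<ge>1. FDP H0 (rejections p \<alpha> k \<omega>) \<le> FDP_bar_Freed \<delta> p \<alpha> k \<omega>}"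
  \<comment> \<open>Monotonicity of the measure below needs the larger set to be measurable; the
    quantifier over \<open>k\<close> is countable.\<close>
  have "good \<in> sets M"
    using FDP_measurable FDP_bar_Freed_measurable unfolding good_def by measurable
  moreover have "space M - B \<subseteq> good"
  proof
    fix \<omega> assume \<omega>: "\<omega> \<in> space M - B"
    have "FDP H0 (rejections p \<alpha> k \<omega>) \<le> FDP_bar_Freed \<delta> p \<alpha> k \<omega>" for k
    proof -
      let ?R = "rejections p \<alpha> k \<omega>"
      have "finite ?R" by (rule finite_subset[of _ "{..k}"]) (auto simp: rejections_def)
      then have "card (?R \<inter> H0) \<le> card ?R" by (intro card_mono) auto
      \<comment> \<open>This settles the cap at 1 in the envelope. The other term follows by
        dividing the bound on false rejections by the common denominator.\<close>
      then have "FDP H0 ?R \<le> 1" by (simp add: FDP_def divide_le_eq_1 max_def)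
      moreover have "FDP H0 ?R
          \<le> (spent_level k \<omega> + freed_Delta \<delta> (spent_level k \<omega>)) / max 1 (real (card ?R))"
        unfolding FDP_def false_rejections_card_eq max.commute[of 1]
        using bound[OF \<omega>] by (intro divide_right_mono) auto
      ultimately show ?thesis by (simp add: FDP_bar_Freed_def spent_level_def)
    qed
    then show "\<omega> \<in> good" using \<omega> by (simp add: good_def)
  qed
  ultimately have "prob (space M - B) \<le> prob good" by (intro finite_measure_mono)
  moreover have "prob (space M - B) = 1 - prob B" by (rule prob_compl[OF B(1)])
  ultimately show ?thesis using B(2) by (simp add: good_def)
qed

end
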